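(* Let $m$ and $k$ be positive integers and let $n\ge 4km$. Then for the hook $\mu=(m,1^{k-1})$ and any permutation $\pi$ in $S_n$: $\pi$ has a subsequence of shape $\mu$ if and only if $\mu\subseteq \mathrm{shape}(\pi)$.
   Context: The Robinson-Schensted(-Knuth) correspondence (by row insertion) associates to a permutation $\pi=(\pi_1,\dots,\pi_n)\in S_n$, written as a word, or more generally to a finite sequence of distinct integers, a pair of tableaux of the same shape; this common shape, a partition of the length of the sequence, is called the shape of the permutation (or sequence), denoted $\mathrm{shape}(\pi)$. A subsequence of $\pi$ is a sequence $(\pi_{i_1},\dots,\pi_{i_r})$ with $i_1<\dots<i_r$, and its shape is its shape as a sequence of distinct integers. The hook $(m,1^{k-1})$ is the partition with first part $m$ followed by $k-1$ parts equal to $1$. For partitions $\mu=(\mu_1,\mu_2,\dots)$ and $\lambda=(\lambda_1,\lambda_2,\dots)$ (padded by zeros, not necessarily of the same number), $\mu\subseteq\lambda$ means $\mu_i\le\lambda_i$ for all $i$. *)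

theory Defs
  imports
    "HOL-Library.Sublist"
    "HOL-Library.More_List"
    "HOL-Combinatorics.Multiset_Permutations"
begin

(* Rows are kept strictly increasing, so the first entry larger than x is the smallest
   entry larger than x.  The second component is the bumped entry, if any. *)
fun row_insert :: "'a::linorder \<Rightarrow> 'a list \<Rightarrow> 'a list \<times> 'a option" where
  "row_insert x [] = ([x], None)"
| "row_insert x (y # ys) =
    (if x < y then (x # ys, Some y)
     else (case row_insert x ys of (r, b) \<Rightarrow> (y # r, b)))"

fun tableau_insert :: "'a::linorder \<Rightarrow> 'a list list \<Rightarrow> 'a list list" where
  "tableau_insert x [] = [[x]]"
| "tableau_insert x (r # rs) =
    (case row_insert x r of
       (r', None) \<Rightarrow> r' # rs
     | (r', Some y) \<Rightarrow> r' # tableau_insert y rs)"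

definition insertion_tableau :: "'a::linorder list \<Rightarrow> 'a list list" where
  "insertion_tableau w = fold tableau_insert w []"

(* Intended for words with distinct entries.  The recording tableau labels each newly created
   cell with its time of creation, so it has the same shape as the insertion tableau and is
   not needed to define the shape.  The result is the list of the nonzero parts. *)
definition rs_shape :: "'a::linorder list \<Rightarrow> nat list" where
  "rs_shape w = map length (insertion_tableau w)"

definition hook :: "nat \<Rightarrow> nat \<Rightarrow> nat list" where
  "hook m k = m # replicate (k - 1) 1"

definition partition_contained :: "nat list \<Rightarrow> nat list \<Rightarrow> bool" where
  "partition_contained \<mu> \<nu> \<longleftrightarrow> (\<forall>i. nth_default 0 \<mu> i \<le> nth_default 0 \<nu> i)"

end

theory Submission
  imports Defs
begin

text \<open>By Schensted's theorem the first part of the shape is the longest length of an increasing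
  subsequence and the number of parts is the longest length of a decreasing one. Hence an increasing
  subsequence of length \<open>m\<close> and a decreasing one of length \<open>k\<close> that share an entry together have
  shape \<open>(m, 1\<^sup>k\<^sup>-\<^sup>1)\<close>, the only partition of \<open>m + k - 1\<close> with first part at least \<open>m\<close> and at
  least \<open>k\<close> parts. To find such a pair, use Erdos-Szekeres: since \<open>n\<close> is at least \<open>4km\<close>, there
  is an increasing subsequence of length \<open>2m\<close> or a decreasing one of length \<open>2k\<close>. A chain of this
  double length either can be rerouted through an element of a given chain of the opposite type,
  or contains an element by which the opposite chain can be extended.\<close>

lemma subseq_ConsE:
  assumes "subseq u (x # w)"
  obtains "subseq u w" | u' where "u = x # u'" "subseq u' w"
  using assms by (cases rule: list_emb.cases) auto

section \<open>Longest monotone subsequences and the insertion tableau\<close>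

text \<open>Insertion of a word is followed one row at a time: the first row evolves independently
  of the rest, and the rows below receive exactly the entries it ejects, in order of
  ejection.\<close>

fun final_row :: "'a::linorder list \<Rightarrow> 'a list \<Rightarrow> 'a list" where
  "final_row r [] = r"
| "final_row r (x # w) = final_row (fst (row_insert x r)) w"

fun bumped :: "'a::linorder list \<Rightarrow> 'a list \<Rightarrow> 'a list" where
  "bumped r [] = []"
| "bumped r (x # w) =
    (case row_insert x r of
       (r', None) \<Rightarrow> bumped r' w
     | (r', Some y) \<Rightarrow> y # bumped r' w)"

lemma row_insert_cases:
  obtains (append) "row_insert x r = (r @ [x], None)" "\<forall>z\<in>set r. z \<le> x"
  | (bump) p y s where "r = p @ y # s" "row_insert x r = (p @ x # s, Some y)" "x < y"
      "\<forall>z\<in>set p. z \<le> x"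
proof (induction r arbitrary: thesis)
  case Nil
  then show ?case by simp
next
  case (Cons a r)
  show ?case
  proof (cases "x < a")
    case True
    then show ?thesis using Cons.prems(2)[of "[]" a r] by simp
  next
    case False
    show ?thesis
    proof (rule Cons.IH)
      assume "row_insert x r = (r @ [x], None)" "\<forall>z\<in>set r. z \<le> x"
      then show ?thesis using False Cons.prems(1) by simp
    next
      fix p y s
      assume "r = p @ y # s" "row_insert x r = (p @ x # s, Some y)" "x < y" "\<forall>z\<in>set p. z \<le> x"
      then show ?thesis using False Cons.prems(2)[of "a # p" y s] by simp
    qed
  qed
qed

lemma sorted_row_insert: "sorted r \<Longrightarrow> sorted (fst (row_insert x r))"
  by (cases rule: row_insert_cases[of x r]) (fastforce simp: sorted_append)+

lemma fold_tableau_insert_Cons: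
  "fold tableau_insert w (r # rs) = final_row r w # fold tableau_insert (bumped r w) rs"
  by (induction w arbitrary: r rs) (auto split: prod.split option.split)

lemma insertion_tableau_rec:
  "w \<noteq> [] \<Longrightarrow> insertion_tableau w = final_row [] w # insertion_tableau (bumped [] w)"
  by (cases w) (simp_all add: insertion_tableau_def fold_tableau_insert_Cons)

text \<open>Each insertion either lengthens the row by one cell or ejects one entry.\<close>

lemma length_final_row_bumped:
  "length (final_row r w) + length (bumped r w) = length r + length w"
proof (induction w arbitrary: r)
  case (Cons x w)
  then show ?case by (cases rule: row_insert_cases[of x r]) simp_all
qed simp

lemma length_final_row_ge: "length r \<le> length (final_row r w)"
proof (induction w arbitrary: r)
  case (Cons x w)
  have "length r \<le> length (fst (row_insert x r))"
    by (cases rule: row_insert_cases[of x r]) simp_all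
  then show ?case using Cons.IH[of "fst (row_insert x r)"] by simp
qed simp

lemma final_row_nonempty: "w \<noteq> [] \<Longrightarrow> final_row [] w \<noteq> []"
  using length_final_row_ge[of "[hd w]" "tl w"] by (cases w) auto

lemma length_bumped_less: "w \<noteq> [] \<Longrightarrow> length (bumped [] w) < length w"
  using length_final_row_bumped[of "[]" w] final_row_nonempty[of w] by (cases "final_row [] w") auto

lemma sum_list_rs_shape: "sum_list (rs_shape w) = length w"
proof (induction w rule: length_induct)
  case (1 w)
  show ?case
  proof (cases "w = []")
    case False
    then have "sum_list (rs_shape w) = length (final_row [] w) + sum_list (rs_shape (bumped [] w))"
      by (simp add: rs_shape_def insertion_tableau_rec)
    then show ?thesis
      using 1 length_bumped_less[OF False] length_final_row_bumped[of "[]" w] by simp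
  qed (simp add: rs_shape_def insertion_tableau_def)
qed

lemma rs_shape_pos: "l \<in> set (rs_shape w) \<Longrightarrow> 0 < l"
proof (induction w rule: length_induct)
  case (1 w)
  show ?case
  proof (cases "w = []")
    case False
    then have "l = length (final_row [] w) \<or> l \<in> set (rs_shape (bumped [] w))"
      using 1(2) by (simp add: rs_shape_def insertion_tableau_rec)
    then show ?thesis
      using 1(1) length_bumped_less[OF False] final_row_nonempty[OF False] by auto
  qed (use 1(2) in \<open>simp add: rs_shape_def insertion_tableau_def\<close>)
qed

text \<open>For a start row \<^term>\<open>r\<close>, an increasing sequence may use the first \<^term>\<open>i\<close> entries of \<^term>\<open>r\<close>
  before \<^term>\<open>u\<close>; this makes the induction on \<^term>\<open>w\<close> go through.\<close>

lemma sorted_subseq_le_final_row: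
  assumes "sorted r" "sorted u" "subseq u w" "i \<le> length r"
    and "\<forall>a\<in>set (take i r). \<forall>b\<in>set u. a \<le> b"
  shows "i + length u \<le> length (final_row r w)"
  using assms
proof (induction w arbitrary: r u i)
  case Nil
  then show ?case by (cases u) auto
next
  case (Cons x w)
  let ?r = "fst (row_insert x r)"
  have sr: "sorted ?r" using Cons.prems(1) by (rule sorted_row_insert)
  show ?case
    using Cons.prems(3)
  proof (cases rule: subseq_ConsE)
    case (2 u')
    note u = 2
    \<comment> \<open>An entry bumped by \<open>x\<close> lies beyond the first \<open>i\<close>
      ones, since those are at most \<open>x\<close>. Hence \<open>x\<close> can be counted into the
      row prefix instead of the sequence.\<close>
    have "Suc i \<le> length ?r \<and> (\<forall>a\<in>set (take (Suc i) ?r). a \<le> x)"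
    proof (cases rule: row_insert_cases[of x r])
      case append
      then show ?thesis using Cons.prems(4) by (auto dest: in_set_takeD)
    next
      case (bump p y s)
      have "i \<le> length p"
      proof (rule ccontr)
        assume "\<not> i \<le> length p"
        then have "y \<in> set (take i r)"
          using bump(1) by (cases "i - length p") auto
        then show False using Cons.prems(5) u(1) bump(3) by auto
      qed
      then show ?thesis using bump
        by (cases "i = length p") (auto dest: in_set_takeD)
    qed
    then have "Suc i + length u' \<le> length (final_row ?r w)"
      using Cons.prems(2) u by (intro Cons.IH sr) force+
    then show ?thesis using u by simp
  next
    case 1
    note u = 1
    have "i \<le> length ?r \<and> (\<forall>a\<in>set (take i ?r). \<exists>a'\<in>set (take i r). a \<le> a')"
    proof (cases rule: row_insert_cases[of x r])
      case append
      then show ?thesis using Cons.prems(4) by auto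
    next
      case (bump p y s)
      then show ?thesis using Cons.prems(4)
        by (cases "i - length p") (auto intro: less_imp_le)
    qed
    then have "i \<le> length ?r" "\<forall>a\<in>set (take i ?r). \<forall>b\<in>set u. a \<le> b"
      using Cons.prems(5) by (blast, meson order_trans)
    then have "i + length u \<le> length (final_row ?r w)"
      using Cons.prems(2) u by (intro Cons.IH sr)
    then show ?thesis by simp
  qed
qed

text \<open>An optimal pair for the row after inserting \<open>x\<close> is pulled back to the old
  row, according to where its prefix ends: before \<open>x\<close> nothing changes, at
  \<open>x\<close> this letter moves to the front of \<open>u\<close>, and past \<open>x\<close> the
  old prefix of equal length serves.\<close>

lemma sorted_subseq_attaining_final_row:
  assumes "sorted r"
  shows "\<exists>i u. i \<le> length r \<and> sorted u \<and> subseq u w \<and> i + length u = length (final_row r w)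
           \<and> (\<forall>a\<in>set (take i r). \<forall>b\<in>set u. a \<le> b)"
  using assms
proof (induction w arbitrary: r)
  case Nil
  then show ?case by (intro exI[of _ "length r"] exI[of _ "[]"]) simp
next
  case (Cons x w)
  let ?r = "fst (row_insert x r)"
  obtain i u where iu: "i \<le> length ?r" "sorted u" "subseq u w"
      "i + length u = length (final_row ?r w)" "\<forall>a\<in>set (take i ?r). \<forall>b\<in>set u. a \<le> b"
    using Cons.IH[OF sorted_row_insert[OF Cons.prems]] by blast
  \<comment> \<open>Both outcomes at once: \<open>t\<close> is the part of \<open>r\<close> from the
    insertion point on, empty when \<open>x\<close> is appended (hence the truncated subtraction)
    and headed by the bumped entry otherwise.\<close>
  obtain p s t where pst: "?r = p @ x # s" "r = p @ t" "length s = length t - 1" "\<forall>z\<in>set p. z \<le> x"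
     "t \<noteq> [] \<Longrightarrow> t = hd t # s" "t = [] \<Longrightarrow> s = []"
    by (cases rule: row_insert_cases[of x r]) force+
  consider "i \<le> length p" | "i = Suc (length p)" | "i > Suc (length p)" by linarith
  then show ?case
  proof cases
    case 1
    then show ?thesis using iu pst by (intro exI[of _ i] exI[of _ u]) auto
  next
    case 2
    then show ?thesis using iu pst
      by (intro exI[of _ "length p"] exI[of _ "x # u"]) auto
  next
    case 3
    then have t: "t \<noteq> []" using iu(1) pst by auto
    have ts: "t = hd t # s" using pst(5) t by simp
    then have len: "length r = length ?r" using pst(1,2) by (metis length_append length_Cons)
    \<comment> \<open>The bumped entry \<open>hd t\<close> has left the row, but its right neighbour
      \<open>hd s\<close> still lies in the prefix and bounds it.\<close>
    have "\<exists>a'\<in>set (take i ?r). a \<le> a'" if "a \<in> set (take i r)" for a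
    proof (cases "a = hd t")
      case True
      obtain j where j: "i = length p + Suc (Suc j)" using 3 by (metis add_Suc_right less_iff_Suc_add add_Suc)
      then have "s \<noteq> []" using iu(1) pst(1) by auto
      then have "hd s \<in> set (take i ?r)" using pst(1) j by (cases s) auto
      moreover have "a \<le> hd s"
        using True Cons.prems pst(2) ts \<open>s \<noteq> []\<close> by (metis hd_in_set sorted_append sorted_simps(2))
      ultimately show ?thesis by blast
    next
      case False
      obtain j where j: "i = length p + Suc j" using 3 by (metis Suc_lessD less_iff_Suc_add add_Suc_right)
      have "take i r = p @ hd t # take j s" using pst(2) ts j by (metis take_Suc_Cons take_append add_diff_cancel_left' take_all le_add1)
      then have "a \<in> set (take i ?r)" using that False j by (auto simp: pst(1))
      then show ?thesis by blast
    qed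
    then have "\<forall>a\<in>set (take i r). \<forall>b\<in>set u. a \<le> b"
      using iu(5) by (meson order_trans)
    then show ?thesis using iu len by (intro exI[of _ i] exI[of _ u]) auto
  qed
qed


text \<open>The decreasing half of Schensted's theorem goes row by row: the rows below the first are the
  tableau of the word of entries bumped from the first row, and passing to that word shortens
  the longest decreasing subsequence by exactly one.\<close>

lemma bumped_of_decreasing:
  assumes "sorted r" "sorted_wrt (>) vs" "subseq vs w"
  shows "\<exists>ds. subseq ds (bumped r w) \<and> sorted_wrt (>) ds \<and> length vs \<le> Suc (length ds)
           \<and> (\<forall>d\<in>set ds. \<exists>v\<in>set vs. d \<le> v)"
    and "\<lbrakk>v \<in> set r; \<forall>x\<in>set vs. x < v\<rbrakk> \<Longrightarrow>
           \<exists>ds. subseq ds (bumped r w) \<and> sorted_wrt (>) ds \<and> length vs \<le> length ds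
             \<and> (\<forall>d\<in>set ds. d \<le> v)"
  using assms
proof (induction w arbitrary: r vs v)
  case Nil
  {
    case 1
    then show ?case by (cases vs) auto
  next
    case 2
    then show ?case by (cases vs) auto
  }
next
  case (Cons x w)
  {
    case 1
    let ?r = "fst (row_insert x r)"
    have sr: "sorted ?r" using 1(1) by (rule sorted_row_insert)
    have sub: "subseq ds (bumped ?r w) \<Longrightarrow> subseq ds (bumped r (x # w))" for ds
      by (auto split: prod.split option.split)
    show ?case
      using 1(3)
    proof (cases rule: subseq_ConsE)
      case 1
      then show ?thesis using Cons.IH(1)[OF sr] \<open>sorted_wrt (>) vs\<close> sub by meson
    next
      case (2 vs')
      \<comment> \<open>Once inserted, \<open>x\<close> is a row entry above all of
        \<open>vs'\<close>; the second claim then loses nothing, so only \<open>x\<close> itself is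
        lost.\<close>
      have "x \<in> set ?r" by (cases rule: row_insert_cases[of x r]) auto
      then obtain ds where "subseq ds (bumped ?r w)" "sorted_wrt (>) ds" "length vs' \<le> length ds"
          "\<forall>d\<in>set ds. d \<le> x"
        using Cons.IH(2)[OF _ _ sr, of x vs'] 2 \<open>sorted_wrt (>) vs\<close> by auto
      then show ?thesis using sub 2 by (intro exI[of _ ds]) auto
    qed
  next
    case 2
    let ?r = "fst (row_insert x r)"
    have sr: "sorted ?r" using 2(3) by (rule sorted_row_insert)
    have sub: "subseq ds (bumped ?r w) \<Longrightarrow> subseq ds (bumped r (x # w))" for ds
      by (auto split: prod.split option.split)
    note asm = 2
    show ?case
      using 2(5)
    proof (cases rule: subseq_ConsE)
      case 1
      show ?thesis
      proof (cases "v \<in> set ?r")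
        case True
        then show ?thesis using Cons.IH(2)[OF True asm(2) sr asm(4) 1] sub by blast
      next
        case False
        \<comment> \<open>The entry \<open>v\<close> is ejected right here; put in front, it makes
          up for the one entry that the first claim may lose.\<close>
        then obtain r' where r': "row_insert x r = (r', Some v)"
          using asm(1) by (cases rule: row_insert_cases[of x r]) auto
        obtain ds where "subseq ds (bumped ?r w)" "sorted_wrt (>) ds" "length vs \<le> Suc (length ds)"
          "\<forall>d\<in>set ds. \<exists>v\<in>set vs. d \<le> v" using Cons.IH(1)[OF sr asm(4) 1] by blast
        then show ?thesis using asm(2) r' by (intro exI[of _ "v # ds"]) fastforce
      qed
    next
      case (2 vs')
      then have "x < v" using asm(2) by simp
      then obtain r' y where r': "row_insert x r = (r', Some y)" "x < y" "y \<le> v" "x \<in> set r'"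
        using asm(1,3) by (cases rule: row_insert_cases[of x r]) (fastforce simp: sorted_append)+
      obtain ds where "subseq ds (bumped ?r w)" "sorted_wrt (>) ds" "length vs' \<le> length ds"
          "\<forall>d\<in>set ds. d \<le> x"
        using Cons.IH(2)[OF _ _ sr, of x vs'] 2 asm(4) r' by auto
      then show ?thesis using r' 2 by (intro exI[of _ "y # ds"]) auto
    qed
  }
qed

text \<open>A bumped entry is traded for the smaller letter that bumped it. An entry absent from the
  row at the start must itself be a letter of \<open>w\<close>, inserted before it is bumped, and
  this yields one more entry; with an empty start row this always applies.\<close>

lemma decreasing_of_bumped:
  assumes "sorted r" "sorted_wrt (>) (b # ds)" "subseq (b # ds) (bumped r w)"
  shows "\<exists>es. subseq es w \<and> sorted_wrt (>) es \<and> length es = Suc (length ds) \<and> (\<forall>e\<in>set es. e < b)"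
    and "b \<notin> set r \<Longrightarrow>
      \<exists>es. subseq es w \<and> sorted_wrt (>) es \<and> length es = Suc (Suc (length ds)) \<and> (\<forall>e\<in>set es. e \<le> b)"
  using assms
proof (induction w arbitrary: r b ds)
  case Nil
  {
    case 1
    then show ?case by simp
  next
    case 2
    then show ?case by simp
  }
next
  case (Cons x w)
  {
    case 1
    let ?r = "fst (row_insert x r)"
    have sr: "sorted ?r" using 1(1) by (rule sorted_row_insert)
    note asm = 1
    show ?case
    proof (cases "subseq (b # ds) (bumped ?r w)")
      case True
      then show ?thesis using Cons.IH(1)[OF sr asm(2) True] by blast
    next
      case False
      then obtain p s where ps: "r = p @ b # s" "row_insert x r = (p @ x # s, Some b)" "x < b"
        "\<forall>z\<in>set p. z \<le> x" and sub: "subseq ds (bumped ?r w)"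
        using asm(3) by (cases rule: row_insert_cases[of x r]) (auto split: if_splits)
      show ?thesis
      proof (cases ds)
        case Nil
        then show ?thesis using ps(3) by (intro exI[of _ "[x]"]) simp
      next
        case (Cons b' ds')
        have b': "b' < b" "sorted_wrt (>) (b' # ds')" using asm(2) Cons by simp_all
        \<comment> \<open>If the next bumped entry \<open>b'\<close> is in the row, it is at most
          \<open>x\<close>, so \<open>x\<close> may precede the chain found for \<open>b'\<close>.
          Otherwise the extra entry gained for \<open>b'\<close> makes up for
          \<open>x\<close>.\<close>
        show ?thesis
        proof (cases "b' \<in> set ?r")
          case True
          then have "b' \<le> x" using ps asm(1) b'(1) by (auto simp: sorted_append)
          moreover obtain es where "subseq es w" "sorted_wrt (>) es" "length es = Suc (length ds')"
            "\<forall>e\<in>set es. e < b'"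
            using Cons.IH(1)[OF sr b'(2)] sub Cons by blast
          ultimately show ?thesis using ps(3) Cons b'(1) by (intro exI[of _ "x # es"]) auto
        next
          case False
          then obtain es where "subseq es w" "sorted_wrt (>) es" "length es = Suc (Suc (length ds'))"
            "\<forall>e\<in>set es. e \<le> b'"
            using Cons.IH(2)[OF False sr b'(2)] sub Cons by blast
          then show ?thesis using Cons b'(1) by (intro exI[of _ es]) auto
        qed
      qed
    qed
  next
    case 2
    let ?r = "fst (row_insert x r)"
    have sr: "sorted ?r" using 2(2) by (rule sorted_row_insert)
    have sub: "subseq (b # ds) (bumped ?r w)"
      using 2(1,4) by (cases rule: row_insert_cases[of x r]) (auto elim: subseq_ConsE)
    show ?case
    proof (cases "b = x")
      case True
      obtain es where "subseq es w" "sorted_wrt (>) es" "length es = Suc (length ds)" "\<forall>e\<in>set es. e < b"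
        using Cons.IH(1)[OF sr 2(3) sub] by blast
      then show ?thesis using True by (intro exI[of _ "x # es"]) auto
    next
      case False
      then have "b \<notin> set ?r"
        using 2(1) by (cases rule: row_insert_cases[of x r]) auto
      then show ?thesis using Cons.IH(2)[OF _ sr 2(3) sub] by blast
    qed
  }
qed

section \<open>Schensted's theorem for the first part and the number of parts\<close>

lemma length_rs_shape_rec: "w \<noteq> [] \<Longrightarrow> length (rs_shape w) = Suc (length (rs_shape (bumped [] w)))"
  by (simp add: rs_shape_def insertion_tableau_rec)

lemma first_part_rs_shape: "nth_default 0 (rs_shape w) 0 = length (final_row [] w)"
  by (cases w) (simp_all add: rs_shape_def insertion_tableau_def fold_tableau_insert_Cons)

lemma increasing_subseq_le_first_part:
  "\<lbrakk>subseq u w; sorted u\<rbrakk> \<Longrightarrow> length u \<le> nth_default 0 (rs_shape w) 0"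
  using sorted_subseq_le_final_row[of "[]" u w 0] by (simp add: first_part_rs_shape)

lemma increasing_subseq_attaining_first_part:
  "\<exists>u. subseq u w \<and> sorted u \<and> length u = nth_default 0 (rs_shape w) 0"
  using sorted_subseq_attaining_final_row[of "[]" w] by (auto simp: first_part_rs_shape)

lemma decreasing_subseq_le_number_of_parts:
  "\<lbrakk>subseq vs w; sorted_wrt (>) vs\<rbrakk> \<Longrightarrow> length vs \<le> length (rs_shape w)"
proof (induction w arbitrary: vs rule: length_induct)
  case (1 w)
  show ?case
  proof (cases "w = []")
    case False
    obtain ds where "subseq ds (bumped [] w)" "sorted_wrt (>) ds" "length vs \<le> Suc (length ds)"
      using bumped_of_decreasing(1)[of "[]" vs w] 1(2,3) by auto
    moreover from this have "length ds \<le> length (rs_shape (bumped [] w))"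
      using 1(1) length_bumped_less[OF False] by blast
    ultimately show ?thesis using length_rs_shape_rec[OF False] by linarith
  qed (use 1(2) in \<open>cases vs; simp\<close>)
qed

lemma decreasing_subseq_attaining_number_of_parts:
  "\<exists>vs. subseq vs w \<and> sorted_wrt (>) vs \<and> length vs = length (rs_shape w)"
proof (induction w rule: length_induct)
  case (1 w)
  show ?case
  proof (cases "w = []")
    case True
    then show ?thesis by (simp add: rs_shape_def insertion_tableau_def)
  next
    case False
    obtain ds where ds: "subseq ds (bumped [] w)" "sorted_wrt (>) ds"
        "length ds = length (rs_shape (bumped [] w))"
      using 1 length_bumped_less[OF False] by blast
    show ?thesis
    proof (cases ds)
      case Nil
      then show ?thesis using ds length_rs_shape_rec[OF False] False
        by (intro exI[of _ "[hd w]"]) (cases w; simp)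
    next
      case (Cons b ds')
      then show ?thesis
        using decreasing_of_bumped(2)[of "[]" b ds' w] ds length_rs_shape_rec[OF False] by auto
    qed
  qed
qed

section \<open>Intersecting chains\<close>

text \<open>Call \<^term>\<open>x\<close> in \<^term>\<open>I\<close> and \<^term>\<open>y\<close> in \<^term>\<open>D\<close> concordant if \<^term>\<open>f\<close> preserves their order.
  If some \<^term>\<open>y\<close> is concordant with many members of \<^term>\<open>I\<close>, those and \<^term>\<open>y\<close> form an increasing
  chain. Otherwise the members of \<^term>\<open>I\<close> discordant with \<^term>\<open>y\<close> lie all on the right of \<^term>\<open>y\<close>
  or all on its left; these discordant sets are nested within each of the two types, and the
  smallest ones of both types meet in an element that extends \<^term>\<open>D\<close>.\<close>

lemma intersecting_chains_if_long_increasing: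
  fixes f :: "'a::linorder \<Rightarrow> 'b::linorder"
  assumes fin: "finite I" "finite D" and inj: "inj_on f (I \<union> D)"
    and inc: "monotone_on I (<) (<) f" and dec: "monotone_on D (<) (>) f"
    and card: "2 * m \<le> card I" and m: "m \<ge> 1"
  shows "\<exists>I' D'. I' \<subseteq> I \<union> D \<and> D' \<subseteq> I \<union> D \<and> monotone_on I' (<) (<) f \<and> monotone_on D' (<) (>) f
           \<and> m \<le> card I' \<and> card D \<le> card D' \<and> (D \<noteq> {} \<longrightarrow> I' \<inter> D' \<noteq> {})"
proof (cases "I \<inter> D = {}")
  case False
  then show ?thesis using inc dec card by (intro exI[of _ I] exI[of _ D]) auto
next
  case disj: True
  define U where "U y = {x\<in>I. x < y \<and> f x < f y \<or> y < x \<and> f y < f x}" for y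
  have ne: "x \<noteq> y \<and> f x \<noteq> f y" if "x \<in> I" "y \<in> D" for x y
    using that disj inj by (auto simp: inj_on_def)
  show ?thesis
  proof (cases "\<exists>y\<in>D. m \<le> card (insert y (U y))")
    case True
    then obtain y where y: "y \<in> D" "m \<le> card (insert y (U y))" by blast
    have "monotone_on (insert y (U y)) (<) (<) f"
      using inc unfolding monotone_on_def U_def by auto
    moreover have "insert y (U y) \<subseteq> I \<union> D" using y by (auto simp: U_def)
    ultimately show ?thesis using y dec
      by (intro exI[of _ "insert y (U y)"] exI[of _ D]) auto
  next
    case False
    have small: "card (U y) < m" if "y \<in> D" for y
    proof -
      have "card (U y) \<le> card (insert y (U y))"
        using fin by (intro card_mono) (auto simp: U_def)
      then show ?thesis using False that by fastforce
    qed
    define R where "R y \<longleftrightarrow> (\<forall>x\<in>I - U y. y < x \<and> f x < f y)" for y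
    define L where "L y \<longleftrightarrow> (\<forall>x\<in>I - U y. x < y \<and> f y < f x)" for y
    \<comment> \<open>A discordant member left of and above \<open>y\<close> and one right of and
      below \<open>y\<close> would violate monotonicity on \<open>I\<close>.\<close>
    have RL: "R y \<or> L y" if y: "y \<in> D" for y
    proof (rule ccontr)
      assume "\<not> (R y \<or> L y)"
      then obtain x x' where "x \<in> I" "x \<notin> U y" "\<not> (y < x \<and> f x < f y)"
        "x' \<in> I" "x' \<notin> U y" "\<not> (x' < y \<and> f y < f x')" unfolding R_def L_def by blast
      moreover from this have "x < y" "f y < f x" "y < x'" "f x' < f y"
        using ne[of x y] ne[of x' y] y unfolding U_def by auto
      ultimately show False
        using inc unfolding monotone_on_def by (meson less_asym' order_less_trans)
    qed
    have nestR: "I - U y' \<subseteq> I - U y" if "y \<in> D" "y' \<in> D" "y \<le> y'" "R y'" for y y'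
    proof (cases "y = y'")
      case False
      then have "y < y'" "f y' < f y" using that dec by (auto simp: monotone_on_def)
      moreover have "y' < x \<and> f x < f y'" if "x \<in> I - U y'" for x
        using \<open>R y'\<close> that unfolding R_def by blast
      ultimately have "x \<notin> U y" if "x \<in> I - U y'" for x
        using that unfolding U_def by (blast dest: less_asym less_trans)
      then show ?thesis by blast
    qed simp
    have nestL: "I - U y' \<subseteq> I - U y" if "y \<in> D" "y' \<in> D" "y' \<le> y" "L y'" for y y'
    proof (cases "y = y'")
      case False
      then have "y' < y" "f y < f y'" using that dec by (auto simp: monotone_on_def)
      moreover have "x < y' \<and> f y' < f x" if "x \<in> I - U y'" for x
        using \<open>L y'\<close> that unfolding L_def by blast
      ultimately have "x \<notin> U y" if "x \<in> I - U y'" for x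
        using that unfolding U_def by (blast dest: less_asym less_trans)
      then show ?thesis by blast
    qed simp
    \<comment> \<open>The discordant sets of type \<open>R\<close> shrink as \<open>y\<close> grows,
      so that of the largest such \<open>y\<close> lies in all others; \<open>T\<close> is its
      complement in \<open>I\<close>, or empty if no \<open>y\<close> has this type.\<close>
    have ex_R: "\<exists>T\<subseteq>I. card T < m \<and> (\<forall>y\<in>D. R y \<longrightarrow> I - T \<subseteq> I - U y)"
    proof (cases "{y\<in>D. R y} = {}")
      case True
      then show ?thesis using m by (intro exI[of _ "{}"]) auto
    next
      case False
      define z where "z = Max {y\<in>D. R y}"
      have z: "z \<in> D" "R z" using Max_in[of "{y\<in>D. R y}"] fin False unfolding z_def by auto
      have "y \<le> z" if "y \<in> D" "R y" for y
        using fin that unfolding z_def by (intro Max_ge) auto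
      then have "I - U z \<subseteq> I - U y" if "y \<in> D" "R y" for y
        using nestR[OF that(1) z(1) _ z(2)] that by blast
      moreover have "U z \<subseteq> I" by (auto simp: U_def)
      ultimately show ?thesis using small[OF z(1)] by blast
    qed
    have ex_L: "\<exists>T\<subseteq>I. card T < m \<and> (\<forall>y\<in>D. L y \<longrightarrow> I - T \<subseteq> I - U y)"
    proof (cases "{y\<in>D. L y} = {}")
      case True
      then show ?thesis using m by (intro exI[of _ "{}"]) auto
    next
      case False
      define z where "z = Min {y\<in>D. L y}"
      have z: "z \<in> D" "L z" using Min_in[of "{y\<in>D. L y}"] fin False unfolding z_def by auto
      have "z \<le> y" if "y \<in> D" "L y" for y
        using fin that unfolding z_def by (intro Min_le) auto
      then have "I - U z \<subseteq> I - U y" if "y \<in> D" "L y" for y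
        using nestL[OF that(1) z(1) _ z(2)] that by blast
      moreover have "U z \<subseteq> I" by (auto simp: U_def)
      ultimately show ?thesis using small[OF z(1)] by blast
    qed
    obtain S where S: "S \<subseteq> I" "card S < m" "\<forall>y\<in>D. R y \<longrightarrow> I - S \<subseteq> I - U y"
      using ex_R by (elim exE conjE)
    obtain T where T: "T \<subseteq> I" "card T < m" "\<forall>y\<in>D. L y \<longrightarrow> I - T \<subseteq> I - U y"
      using ex_L by (elim exE conjE)
    \<comment> \<open>Here the double length is used: two exceptional sets of fewer than
      \<open>m\<close> elements cannot exhaust \<open>I\<close>, so some \<open>x\<close> is
      discordant with all of \<open>D\<close>.\<close>
    have "card (S \<union> T) < card I" using card_Un_le[of S T] S(2) T(2) card by linarith
    then have "S \<union> T \<noteq> I" by auto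
    then obtain x where x: "x \<in> I" "x \<notin> S" "x \<notin> T" using S(1) T(1) by blast
    have "x \<notin> U y" if "y \<in> D" for y
      using RL[OF that] S(3)[rule_format, OF that] T(3)[rule_format, OF that] x by blast
    then have disc: "x < y \<and> f y < f x \<or> y < x \<and> f x < f y" if "y \<in> D" for y
      using ne[OF x(1) that] x(1) \<open>\<And>y. y \<in> D \<Longrightarrow> x \<notin> U y\<close>[OF that] unfolding U_def by auto
    have "monotone_on (insert x D) (<) (>) f"
      using dec disc unfolding monotone_on_def by force
    then show ?thesis
      using inc card fin x(1) by (intro exI[of _ I] exI[of _ "insert x D"]) (auto intro: card_mono)
  qed
qed

text \<open>Label each element by the largest size of an increasing chain ending there. Labels lie
  between 1 and \<open>a\<close>, and elements with equal labels form a decreasing chain, so each of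
  the at most \<open>a\<close> fibres has at most \<open>b\<close> elements.\<close>

lemma Erdos_Szekeres:
  fixes f :: "'a::linorder \<Rightarrow> 'b::linorder"
  assumes fin: "finite A" and inj: "inj_on f A"
    and inc: "\<And>I. I \<subseteq> A \<Longrightarrow> monotone_on I (<) (<) f \<Longrightarrow> card I \<le> a"
    and dec: "\<And>D. D \<subseteq> A \<Longrightarrow> monotone_on D (<) (>) f \<Longrightarrow> card D \<le> b"
  shows "card A \<le> a * b"
proof -
  define C where "C x = {I. I \<subseteq> A \<and> monotone_on I (<) (<) f \<and> x \<in> I \<and> (\<forall>y\<in>I. y \<le> x)}" for x
  define c where "c x = Max (card ` C x)" for x
  have finC: "finite (C x)" for x
    by (rule finite_subset[of _ "Pow A"]) (use fin in \<open>auto simp: C_def\<close>)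
  have neC: "{x} \<in> C x" if "x \<in> A" for x using that by (auto simp: C_def monotone_on_def)
  have c: "\<exists>I\<in>C x. c x = card I" if "x \<in> A" for x
    using Max_in[of "card ` C x"] finC neC[OF that] unfolding c_def by blast
  have c_ge: "I \<in> C x \<Longrightarrow> card I \<le> c x" for I x
    unfolding c_def using finC by (intro Max_ge) auto
  have less: "c x < c y" if xy: "x \<in> A" "y \<in> A" "x < y" "f x < f y" for x y
  proof -
    obtain I where I: "I \<in> C x" "c x = card I" using c xy(1) by blast
    have below: "z < y \<and> f z < f y" if "z \<in> I" for z
    proof (cases "z = x")
      case False
      then have "z < x" "f z < f x"
        using I(1) that unfolding C_def monotone_on_def by (auto simp: less_le)
      then show ?thesis using xy by auto
    qed (use xy in auto)
    then have "insert y I \<in> C y"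
      using I(1) xy(2) unfolding C_def monotone_on_def by (auto dest: less_asym less_imp_le)
    moreover have "y \<notin> I" "finite I" using I xy fin by (auto simp: C_def dest: finite_subset)
    ultimately show ?thesis using c_ge I(2) by fastforce
  qed
  have "c x \<in> {1..a}" if "x \<in> A" for x
    using c[OF that] c_ge[OF neC[OF that]] inc by (auto simp: C_def)
  then have "card A \<le> card (\<Union>t\<in>{1..a}. {x\<in>A. c x = t})"
    using fin by (intro card_mono) auto
  also have "\<dots> \<le> (\<Sum>t\<in>{1..a}. card {x\<in>A. c x = t})" by (rule card_UN_le) simp
  also have "\<dots> \<le> (\<Sum>t\<in>{1..a}. b)"
  proof (intro sum_mono dec)
    fix t
    show "monotone_on {x\<in>A. c x = t} (<) (>) f"
      unfolding monotone_on_def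
    proof clarify
      fix x y assume "x \<in> A" "y \<in> A" "x < y" "t = c x" "c y = c x"
      then show "f y < f x" using less[of x y] inj by (metis inj_onD less_irrefl linorder_neqE)
    qed
  qed auto
  finally show ?thesis by simp
qed

section \<open>Chains of exact sizes with one common element\<close>

lemma subset_of_card_containing:
  assumes "finite A" "x \<in> A" "1 \<le> n" "n \<le> card A"
  obtains B where "B \<subseteq> A" "x \<in> B" "card B = n"
proof -
  have "n - 1 \<le> card (A - {x})" using assms by simp
  then obtain B where B: "B \<subseteq> A - {x}" "card B = n - 1" "finite B" by (rule obtain_subset_with_card_n)
  then have "card (insert x B) = n" using assms(3) by (subst card_insert_disjoint) auto
  then show ?thesis using B assms(2) by (intro that[of "insert x B"]) auto
qed

text \<open>The values are integers so that negating \<open>f\<close> exchanges increasing and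
  decreasing chains; one intersection lemma then serves both outcomes of Erdos-Szekeres.\<close>

lemma intersecting_chains:
  fixes f :: "'a::linorder \<Rightarrow> int"
  assumes fin: "finite A" and inj: "inj_on f A" and card: "4 * k * m \<le> card A" and "1 \<le> m" "1 \<le> k"
    and I: "I \<subseteq> A" "monotone_on I (<) (<) f" "m \<le> card I"
    and D: "D \<subseteq> A" "monotone_on D (<) (>) f" "k \<le> card D"
  obtains I' D' where "I' \<subseteq> A" "monotone_on I' (<) (<) f" "card I' = m"
    "D' \<subseteq> A" "monotone_on D' (<) (>) f" "card D' = k" "card (I' \<union> D') = m + k - 1"
proof -
  have "\<exists>I' D'. I' \<subseteq> A \<and> D' \<subseteq> A \<and> monotone_on I' (<) (<) f \<and> monotone_on D' (<) (>) f
           \<and> m \<le> card I' \<and> k \<le> card D' \<and> I' \<inter> D' \<noteq> {}"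
  proof (cases "\<exists>I\<subseteq>A. monotone_on I (<) (<) f \<and> 2 * m \<le> card I")
    case True
    then obtain J where J: "J \<subseteq> A" "monotone_on J (<) (<) f" "2 * m \<le> card J" by blast
    have "D \<noteq> {}" using D \<open>1 \<le> k\<close> by auto
    moreover have "J \<union> D \<subseteq> A" using J D by blast
    moreover have "finite J" "finite D" using J D fin by (auto dest: finite_subset)
    moreover have "inj_on f (J \<union> D)" using inj J D by (auto intro: inj_on_subset)
    ultimately show ?thesis
      using intersecting_chains_if_long_increasing[of J D f m] J D \<open>1 \<le> m\<close>
      by (meson order_trans)
  next
    case False
    have "\<exists>D\<subseteq>A. monotone_on D (<) (>) f \<and> 2 * k \<le> card D"
    proof (rule ccontr)
      assume no: "\<not> ?thesis"
      have "card A \<le> (2 * m - 1) * (2 * k - 1)"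
        by (rule Erdos_Szekeres[OF fin inj]) (use False no in fastforce)+
      also have "\<dots> < (2 * m) * (2 * k)"
        using \<open>1 \<le> m\<close> \<open>1 \<le> k\<close> by (intro mult_strict_mono) auto
      finally show False using card by (simp add: mult.commute)
    qed
    then obtain J where J: "J \<subseteq> A" "monotone_on J (<) (>) f" "2 * k \<le> card J" by blast
    let ?g = "\<lambda>x. - f x"
    have "I \<noteq> {}" using I \<open>1 \<le> m\<close> by auto
    moreover have "J \<union> I \<subseteq> A" using J I by blast
    moreover have "finite J" "finite I" using J I fin by (auto dest: finite_subset)
    moreover have "inj_on ?g (J \<union> I)" using inj J I by (auto simp: inj_on_def)
    moreover have swap: "monotone_on S (<) (<) ?g \<longleftrightarrow> monotone_on S (<) (>) f"
      "monotone_on S (<) (>) ?g \<longleftrightarrow> monotone_on S (<) (<) f" for S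
      by (auto simp: monotone_on_def)
    ultimately obtain D' I' where "D' \<subseteq> J \<union> I" "I' \<subseteq> J \<union> I" "monotone_on D' (<) (>) f"
      "monotone_on I' (<) (<) f" "k \<le> card D'" "card I \<le> card I'" "D' \<inter> I' \<noteq> {}"
      using intersecting_chains_if_long_increasing[of J I ?g k] J I \<open>1 \<le> k\<close> by auto
    then show ?thesis using I(3) \<open>J \<union> I \<subseteq> A\<close>
      by (intro exI[of _ I'] exI[of _ D']) auto
  qed
  then obtain I' D' x where ID: "I' \<subseteq> A" "D' \<subseteq> A" "monotone_on I' (<) (<) f"
    "monotone_on D' (<) (>) f" "m \<le> card I'" "k \<le> card D'" "x \<in> I'" "x \<in> D'" by blast
  then have finID: "finite I'" "finite D'" using fin by (auto dest: finite_subset)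
  obtain I'' where I'': "I'' \<subseteq> I'" "x \<in> I''" "card I'' = m"
    using subset_of_card_containing[OF finID(1) ID(7) \<open>1 \<le> m\<close> ID(5)] .
  obtain D'' where D'': "D'' \<subseteq> D'" "x \<in> D''" "card D'' = k"
    using subset_of_card_containing[OF finID(2) ID(8) \<open>1 \<le> k\<close> ID(6)] .
  have mono: "monotone_on I'' (<) (<) f" "monotone_on D'' (<) (>) f"
    using ID I'' D'' by (auto intro: monotone_on_subset)
  \<comment> \<open>An increasing and a decreasing chain share at most one element, which gives the
    union its exact size \<open>m + k - 1\<close>.\<close>
  have "y = x" if "y \<in> I''" "y \<in> D''" for y
    using mono I''(2) D''(2) that unfolding monotone_on_def by (metis less_asym' linorder_neqE)
  then have "I'' \<inter> D'' = {x}" using I''(2) D''(2) by blast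
  then have "card (I'' \<union> D'') + 1 = m + k"
    using card_Un_Int[of I'' D''] I'' D'' finID finite_subset[of I'' I'] finite_subset[of D'' D'] by simp
  then show ?thesis using that[of I'' D''] mono I'' D'' ID by auto
qed

section \<open>Hook shapes\<close>

text \<open>Passes from subsequences to sets of positions. The bound on \<open>j\<close> reflects
  that \<open>nths\<close> ignores positions past the end.\<close>

lemma sorted_wrt_nths_iff:
  "sorted_wrt P (nths w S) \<longleftrightarrow> (\<forall>i\<in>S. \<forall>j\<in>S. i < j \<longrightarrow> j < length w \<longrightarrow> P (w ! i) (w ! j))"
proof (induction w rule: rev_induct)
  case (snoc x w)
  show ?case
    by (auto simp: nths_append sorted_wrt_append snoc set_nths nth_append less_Suc_eq)
qed simp

lemma subseq_nths_mono: "S \<subseteq> T \<Longrightarrow> subseq (nths w S) (nths w T)"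
proof (induction w rule: rev_induct)
  case (snoc x w)
  then show ?case by (auto simp: nths_append intro: list_emb_append_mono)
qed simp

lemma sum_list_ge_length: "\<forall>l\<in>set t. 0 < l \<Longrightarrow> length t \<le> sum_list (t :: nat list)"
  by (induction t) auto

lemma sum_list_eq_length: "\<lbrakk>\<forall>l\<in>set t. 0 < l; sum_list t = length t\<rbrakk> \<Longrightarrow> t = replicate (length t) (1 :: nat)"
proof (induction t)
  case (Cons a t)
  then show ?case using sum_list_ge_length[of t] by auto
qed simp

text \<open>The tail has at least \<open>k - 1\<close> positive parts, so the total
  \<open>m + k - 1\<close> leaves no slack in the first part, in the number of parts or in their
  sizes.\<close>

lemma rs_shape_eq_hookI:
  assumes "1 \<le> m" "1 \<le> k" "m \<le> nth_default 0 (rs_shape w) 0" "k \<le> length (rs_shape w)"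
    and "length w = m + k - 1"
  shows "rs_shape w = hook m k"
proof -
  obtain a t where at: "rs_shape w = a # t" using assms(2,4) by (cases "rs_shape w") auto
  have pos: "\<forall>l\<in>set t. 0 < l" using rs_shape_pos[of _ w] at by auto
  have "a + sum_list t = m + k - 1" using sum_list_rs_shape[of w] at assms(5) by simp
  then have "a = m" "length t = k - 1" "sum_list t = length t"
    using sum_list_ge_length[OF pos] assms(1-4) at by auto
  then show ?thesis using sum_list_eq_length[OF pos] at by (simp add: hook_def)
qed

lemma partition_contained_hook_iff:
  assumes "1 \<le> m" "1 \<le> k"
  shows "partition_contained (hook m k) (rs_shape w) \<longleftrightarrow>
    m \<le> nth_default 0 (rs_shape w) 0 \<and> k \<le> length (rs_shape w)" (is "?L \<longleftrightarrow> ?R")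
proof
  assume ?L
  then have le: "nth_default 0 (hook m k) i \<le> nth_default 0 (rs_shape w) i" for i
    by (simp add: partition_contained_def)
  have "0 < nth_default 0 (hook m k) (k - 1)"
    using assms by (auto simp: hook_def nth_default_def nth_Cons')
  then have "k - 1 < length (rs_shape w)"
    using le[of "k - 1"] by (auto simp: nth_default_def split: if_splits)
  then show ?R using le[of 0] by (auto simp: hook_def)
next
  assume R: ?R
  show ?L
    unfolding partition_contained_def
  proof
    fix i
    show "nth_default 0 (hook m k) i \<le> nth_default 0 (rs_shape w) i"
    proof (cases i)
      case 0
      then show ?thesis using R by (simp add: hook_def)
    next
      case (Suc j)
      have "1 \<le> nth_default 0 (rs_shape w) (Suc j)" if "j < k - 1"
      proof -
        have "Suc j < length (rs_shape w)" using that R by linarith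
        then show ?thesis using rs_shape_pos[of "rs_shape w ! Suc j" w] by (simp add: nth_default_nth)
      qed
      then show ?thesis using Suc by (auto simp: hook_def nth_default_def split: if_splits)
    qed
  qed
qed

theorem theorem3:
  fixes m k n :: nat and \<pi> :: "nat list"
  assumes "m \<ge> 1" and "k \<ge> 1" and "n \<ge> 4 * k * m"
    and "\<pi> \<in> permutations_of_set {1..n}"
  shows "(\<exists>\<sigma>. subseq \<sigma> \<pi> \<and> rs_shape \<sigma> = hook m k)
         \<longleftrightarrow> partition_contained (hook m k) (rs_shape \<pi>)"
proof
  assume "\<exists>\<sigma>. subseq \<sigma> \<pi> \<and> rs_shape \<sigma> = hook m k"
  then obtain \<sigma> where \<sigma>: "subseq \<sigma> \<pi>" "rs_shape \<sigma> = hook m k" by blast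
  have "nth_default 0 (rs_shape \<sigma>) 0 = m" "length (rs_shape \<sigma>) = k"
    using \<sigma>(2) assms(2) by (simp_all add: hook_def)
  \<comment> \<open>Monotone subsequences of \<open>\<sigma>\<close> are also subsequences of
    \<open>\<pi>\<close>, so both of its extremal lengths are lower bounds for those of
    \<open>\<pi>\<close>.\<close>
  then obtain u v where "subseq u \<sigma>" "sorted u" "length u = m"
    "subseq v \<sigma>" "sorted_wrt (>) v" "length v = k"
    using increasing_subseq_attaining_first_part[of \<sigma>]
      decreasing_subseq_attaining_number_of_parts[of \<sigma>] by metis
  then show "partition_contained (hook m k) (rs_shape \<pi>)"
    using increasing_subseq_le_first_part[of u \<pi>] decreasing_subseq_le_number_of_parts[of v \<pi>]
      \<sigma>(1) assms(1,2) by (auto simp: partition_contained_hook_iff intro: subseq_order.order_trans)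
next
  assume "partition_contained (hook m k) (rs_shape \<pi>)"
  then have le: "m \<le> nth_default 0 (rs_shape \<pi>) 0" "k \<le> length (rs_shape \<pi>)"
    using assms(1,2) by (simp_all add: partition_contained_hook_iff)
  let ?A = "{..<length \<pi>}" and ?f = "\<lambda>i. int (\<pi> ! i)"
  have dist: "distinct \<pi>" and len: "length \<pi> = n"
    using assms(4) by (auto simp: permutations_of_set_def dest: distinct_card)
  have inj: "inj_on ?f ?A" using dist by (auto simp: inj_on_def nth_eq_iff_index_eq)
  have length: "length (nths \<pi> S) = card S" if "S \<subseteq> ?A" for S
    using that unfolding length_nths by (intro arg_cong[of _ _ card]) auto
  \<comment> \<open>The entries are distinct, so weakly sorted and strictly increasing
    agree.\<close>
  have sorted: "sorted (nths \<pi> S) \<longleftrightarrow> monotone_on S (<) (<) ?f" if "S \<subseteq> ?A" for S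
    unfolding sorted_wrt_nths_iff monotone_on_def
    using that dist by (auto simp: nat_less_le nth_eq_iff_index_eq subset_eq)
  have sorted_rev: "sorted_wrt (>) (nths \<pi> S) \<longleftrightarrow> monotone_on S (<) (>) ?f" if "S \<subseteq> ?A" for S
    unfolding sorted_wrt_nths_iff monotone_on_def using that by auto
  have nths: "\<exists>S\<subseteq>?A. u = nths \<pi> S" if u: "subseq u \<pi>" for u
  proof -
    obtain N where "u = nths \<pi> N" using u subseq_conv_nths by blast
    have "subseq (nths \<pi> (N \<inter> ?A)) (nths \<pi> N)" by (rule subseq_nths_mono) simp
    moreover have "length (nths \<pi> (N \<inter> ?A)) = length (nths \<pi> N)"
      unfolding length_nths by (rule arg_cong[of _ _ card]) auto
    ultimately have "nths \<pi> (N \<inter> ?A) = nths \<pi> N" by (rule subseq_same_length)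
    with \<open>u = nths \<pi> N\<close> show ?thesis by (intro exI[of _ "N \<inter> ?A"]) simp
  qed
  obtain u where u: "subseq u \<pi>" "sorted u" "length u = nth_default 0 (rs_shape \<pi>) 0"
    using increasing_subseq_attaining_first_part by blast
  obtain I where "I \<subseteq> ?A" "u = nths \<pi> I" using nths[OF u(1)] by (elim exE conjE)
  then have I: "I \<subseteq> ?A" "monotone_on I (<) (<) ?f" "m \<le> card I"
    using u sorted[of I] length[of I] le(1) by simp_all
  obtain v where v: "subseq v \<pi>" "sorted_wrt (>) v" "length v = length (rs_shape \<pi>)"
    using decreasing_subseq_attaining_number_of_parts by blast
  obtain D where "D \<subseteq> ?A" "v = nths \<pi> D" using nths[OF v(1)] by (elim exE conjE)
  then have D: "D \<subseteq> ?A" "monotone_on D (<) (>) ?f" "k \<le> card D"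
    using v sorted_rev[of D] length[of D] le(2) by simp_all
  obtain I' D' where ID: "I' \<subseteq> ?A" "monotone_on I' (<) (<) ?f" "card I' = m"
    "D' \<subseteq> ?A" "monotone_on D' (<) (>) ?f" "card D' = k" "card (I' \<union> D') = m + k - 1"
    using intersecting_chains[OF _ inj _ assms(1,2) I D] assms(3) len by auto
  \<comment> \<open>Both chains survive inside the merged subsequence, so its shape has first part
    at least \<open>m\<close> and at least \<open>k\<close> parts; its length then forces the
    hook.\<close>
  let ?\<sigma> = "nths \<pi> (I' \<union> D')"
  have "m \<le> nth_default 0 (rs_shape ?\<sigma>) 0"
    using increasing_subseq_le_first_part[OF subseq_nths_mono[of I' "I' \<union> D'" \<pi>]] ID sorted length by auto
  moreover have "k \<le> length (rs_shape ?\<sigma>)"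
    using decreasing_subseq_le_number_of_parts[OF subseq_nths_mono[of D' "I' \<union> D'" \<pi>]]
      ID sorted_rev length by auto
  ultimately have "rs_shape ?\<sigma> = hook m k"
    using ID length assms(1,2) by (intro rs_shape_eq_hookI) auto
  then show "\<exists>\<sigma>. subseq \<sigma> \<pi> \<and> rs_shape \<sigma> = hook m k"
    using subseq_conv_nths by blast
qed

end
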